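(* Let $\nu=\nu_1\nu_2\cdots\nu_{k-1}$ be a word of distinct integers in $[k]$, and let $r$ be the unique element of $[k]\setminus\{\nu_1,\ldots,\nu_{k-1}\}$. Let $\alpha=(\nu;\,r\to\nu_i)$, where $i\in[k-1]$ is such that $r>\nu_i$. Then $\alpha\sim\alpha^{rc}$.
   Context: $[n]=\{1,\dots,n\}$, and $\mathcal{S}_n$ is the set of permutations $\pi=\pi_1\pi_2\cdots\pi_n$ of $[n]$ in one-line notation. The permutation $\hat\pi$: for $\pi\in\mathcal{S}_n$, $\hat\pi\in\mathcal{S}_n$ is the permutation whose cycle form is obtained from the word $\pi_1\cdots\pi_n$ by inserting a left parenthesis before each left-to-right maximum (an entry larger than all entries to its left) and a right parenthesis immediately before the next left-to-right maximum, or at the end of the word. A cycle $(c_1,c_2,\dots,c_s)$ means $c_1\mapsto c_2\mapsto\cdots\mapsto c_s\mapsto c_1$. Example: if $\pi=2537164$ then $\hat\pi=(2)(53)(7164)$. Arrow patterns: an arrow pattern of size $k$ is a pair $(\nu;H)$ where $\nu=\nu_1\cdots\nu_m$ is a word of distinct positive integers, $H$ is a collection of arrows $b_i\to c_i$, and the set of all integers appearing in $\nu$ or $H$ is $[k]$. A permutation $\pi\in\mathcal{S}_n$ contains $(\nu;H)$ if there are a set $X=\{x_1<x_2<\cdots<x_k\}\subseteq[n]$ and indices $t_1<\cdots<t_m$ such that $\pi_{t_1}\pi_{t_2}\cdots\pi_{t_m}=x_{\nu_1}x_{\nu_2}\cdots x_{\nu_m}$ and $\hat\pi(x_{b_i})=x_{c_i}$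 for every arrow $b_i\to c_i$ in $H$. Otherwise $\pi$ avoids $(\nu;H)$. $\mathcal{S}_n(\nu;H)$ is the set of permutations in $\mathcal{S}_n$ avoiding $(\nu;H)$. Two arrow patterns $\alpha,\beta$ are arrow-Wilf-equivalent, written $\alpha\sim\beta$, if $|\mathcal{S}_n(\alpha)|=|\mathcal{S}_n(\beta)|$ for all $n\ge 1$. Operations on an arrow pattern $\alpha=(\nu;H)$ of size $k$, with $\nu=\nu_1\cdots\nu_m$ and $H=\{b_i\to c_i:1\le i\le t\}$: the reverse is $\alpha^r=(\nu_m\nu_{m-1}\cdots\nu_1;\{c_i\to b_i:1\le i\le t\})$; the complement is $\alpha^c=((k+1-\nu_1)\cdots(k+1-\nu_m);\{k+1-b_i\to k+1-c_i:1\le i\le t\})$; the reverse-complement is $\alpha^{rc}=(\alpha^r)^c=(\alpha^c)^r$. *)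

theory Defs
  imports "HOL-Combinatorics.Combinatorics" "HOL-Library.Sublist"
begin

text \<open>
  A permutation \<open>\<pi>\<close> of \<open>{1..n}\<close> in one-line notation is a list in
  \<^term>\<open>permutations_of_set {1..n::nat}\<close>.
\<close>

text \<open>
  The word is cut immediately before each left-to-right maximum. The head of a nonempty word is
  always one, and the next one is the first larger entry. That entry exceeds everything before
  it, so the left-to-right maxima of the remaining suffix are left-to-right maxima of the whole
  word; see \<open>map_hd_lr_max_blocks\<close> below.
\<close>

function lr_max_blocks :: "nat list \<Rightarrow> nat list list" where
  "lr_max_blocks [] = []"
| "lr_max_blocks (x # xs) =
     (x # takeWhile (\<lambda>y. y \<le> x) xs) # lr_max_blocks (dropWhile (\<lambda>y. y \<le> x) xs)"
  by pat_completeness auto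
termination
  by (relation "measure length") (auto simp: length_dropWhile_le less_Suc_eq_le)

text \<open>
  \<^term>\<open>cycle_of_list [c\<^sub>1, c\<^sub>2, c\<^sub>3]\<close> maps \<open>c\<^sub>1 \<mapsto> c\<^sub>2 \<mapsto> c\<^sub>3 \<mapsto> c\<^sub>1\<close>. The blocks of a
  permutation are disjoint, so the order of composition is irrelevant.
\<close>

definition hat_perm :: "nat list \<Rightarrow> nat \<Rightarrow> nat" where
  "hat_perm w = foldr (\<circ>) (map cycle_of_list (lr_max_blocks w)) id"

lemma concat_lr_max_blocks: "concat (lr_max_blocks w) = w"
  by (induction w rule: lr_max_blocks.induct) auto

lemma Nil_notin_lr_max_blocks: "[] \<notin> set (lr_max_blocks w)"
  by (induction w rule: lr_max_blocks.induct) auto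

lemma map_hd_lr_max_blocks:
  "map hd (lr_max_blocks w) = map ((!) w) (filter (\<lambda>i. \<forall>j<i. w ! j < w ! i) [0..<length w])"
proof (induction w rule: lr_max_blocks.induct)
  case 1
  then show ?case by simp
next
  case (2 x xs)
  define ys where "ys = x # takeWhile (\<lambda>y. y \<le> x) xs"
  define zs where "zs = dropWhile (\<lambda>y. y \<le> x) xs"
  let ?P = "\<lambda>w i. \<forall>j<i. w ! j < (w ! i :: nat)"
  have split: "x # xs = ys @ zs" by (simp add: ys_def zs_def)
  have le: "y \<le> x" if "y \<in> set ys" for y
    using that by (auto simp: ys_def dest: set_takeWhileD)
  have gt: "x < hd zs" if "zs \<noteq> []"
    using hd_dropWhile[of "\<lambda>y. y \<le> x" xs] that by (auto simp: zs_def)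
  have A: "filter (?P (ys @ zs)) [0..<length ys] = [0]"
  proof -
    have "?P (ys @ zs) i \<longleftrightarrow> i = 0" if "i < length ys" for i
    proof
      assume *: "?P (ys @ zs) i"
      show "i = 0"
      proof (rule ccontr)
        assume "i \<noteq> 0"
        then have "(ys @ zs) ! 0 < (ys @ zs) ! i" using * by blast
        moreover have "(ys @ zs) ! 0 = x" by (simp add: ys_def)
        moreover have "(ys @ zs) ! i = ys ! i" using that by (simp add: nth_append)
        ultimately have "x < ys ! i" by simp
        then show False using le[of "ys ! i"] that by simp
      qed
    qed simp
    then have "filter (?P (ys @ zs)) [0..<length ys] = filter (\<lambda>i. i = 0) [0..<length ys]"
      by (intro filter_cong) auto
    also have "\<dots> = filter (\<lambda>i. i = 0) (0 # [1..<length ys])"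
      using upt_conv_Cons[of 0 "length ys"] by (simp add: ys_def)
    also have "\<dots> = [0]"
      by (simp add: filter_empty_conv)
    finally show ?thesis .
  qed
  have B: "?P (ys @ zs) (length ys + i) \<longleftrightarrow> ?P zs i" if "i < length zs" for i
  proof
    assume *: "?P (ys @ zs) (length ys + i)"
    show "?P zs i"
    proof (intro allI impI)
      fix j assume "j < i"
      then have "(ys @ zs) ! (length ys + j) < (ys @ zs) ! (length ys + i)"
        using *[rule_format, of "length ys + j"] by (simp only: add_less_cancel_left)
      then show "zs ! j < zs ! i" by simp
    qed
  next
    assume *: "?P zs i"
    have "hd zs \<le> zs ! i"
    proof (cases "i = 0")
      case True
      then show ?thesis using that by (cases zs) auto
    next
      case False
      then have "zs ! 0 < zs ! i" using * by blast
      then show ?thesis using that by (cases zs) auto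
    qed
    then have x: "x < zs ! i" using gt that by fastforce
    show "?P (ys @ zs) (length ys + i)"
    proof (intro allI impI)
      fix j assume j: "j < length ys + i"
      show "(ys @ zs) ! j < (ys @ zs) ! (length ys + i)"
      proof (cases "j < length ys")
        case True
        then have "ys ! j \<le> x" by (intro le) simp
        then show ?thesis using x True by (simp add: nth_append)
      next
        case False
        then have "zs ! (j - length ys) < zs ! i" using * j by simp
        then show ?thesis using False by (simp add: nth_append)
      qed
    qed
  qed
  have "[0..<length (ys @ zs)] = [0..<length ys] @ map (\<lambda>i. length ys + i) [0..<length zs]"
    using upt_add_eq_append[of 0 "length ys" "length zs"] map_add_upt[of "length ys" "length zs"]
    by (simp add: add.commute)
  then have "filter (?P (ys @ zs)) [0..<length (ys @ zs)] =
      0 # map (\<lambda>i. length ys + i)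
        (filter (\<lambda>i. ?P (ys @ zs) (length ys + i)) [0..<length zs])"
    by (simp only: filter_append A filter_map o_def append_Cons append_Nil)
  also have "filter (\<lambda>i. ?P (ys @ zs) (length ys + i)) [0..<length zs] =
      filter (?P zs) [0..<length zs]"
    using B by (intro filter_cong) auto
  finally have "map ((!) (ys @ zs)) (filter (?P (ys @ zs)) [0..<length (ys @ zs)]) =
      (ys @ zs) ! 0 # map ((!) zs) (filter (?P zs) [0..<length zs])"
    by (simp only: list.map map_map) (simp add: o_def)
  moreover have "(ys @ zs) ! 0 = x" by (simp add: ys_def)
  moreover have "map hd (lr_max_blocks (x # xs)) = x # map hd (lr_max_blocks zs)"
    by (simp add: zs_def)
  moreover have "map hd (lr_max_blocks zs) = map ((!) zs) (filter (?P zs) [0..<length zs])"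
    using 2 unfolding zs_def .
  ultimately show ?case unfolding split by simp
qed

lemma "lr_max_blocks [2, 5, 3, 7, 1, 6, 4] = [[2], [5, 3], [7, 1, 6, 4]]"
  by simp

lemma "map (hat_perm [2, 5, 3, 7, 1, 6, 4]) [1..<8] = [6, 2, 5, 7, 3, 4, 1]"
  by (simp add: hat_perm_def upt_rec numeral_eq_Suc transpose_def)

text \<open>
  A pair \<open>(\<nu>, H)\<close>, where \<open>(b, c) \<in> H\<close> stands for the arrow \<open>b \<rightarrow> c\<close>.
\<close>

type_synonym arrow_pat = "nat list \<times> (nat \<times> nat) set"

definition pat_entries :: "arrow_pat \<Rightarrow> nat set" where
  "pat_entries \<alpha> = set (fst \<alpha>) \<union> fst ` snd \<alpha> \<union> snd ` snd \<alpha>"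

text \<open>
  The set of entries of a pattern of size \<open>k\<close> is \<open>{1..k}\<close>, so the pattern determines \<open>k\<close>.
\<close>

definition pat_size :: "arrow_pat \<Rightarrow> nat" where
  "pat_size \<alpha> = card (pat_entries \<alpha>)"

definition is_arrow_pattern :: "arrow_pat \<Rightarrow> bool" where
  "is_arrow_pattern \<alpha> \<longleftrightarrow> distinct (fst \<alpha>) \<and> pat_entries \<alpha> = {1..pat_size \<alpha>}"

text \<open>
  The function \<open>x\<close> is the increasing enumeration \<open>x 1 < \<dots> < x k\<close> of the set \<open>X\<close>.
\<close>

definition contains_pat :: "nat list \<Rightarrow> arrow_pat \<Rightarrow> bool" where
  "contains_pat w \<alpha> \<longleftrightarrow>
     (\<exists>x. strict_mono_on {1..pat_size \<alpha>} x \<and> x ` {1..pat_size \<alpha>} \<subseteq> {1..length w} \<and>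
          subseq (map x (fst \<alpha>)) w \<and> (\<forall>(b, c)\<in>snd \<alpha>. hat_perm w (x b) = x c))"

definition avoiders :: "nat \<Rightarrow> arrow_pat \<Rightarrow> nat list set" where
  "avoiders n \<alpha> = {w \<in> permutations_of_set {1..n}. \<not> contains_pat w \<alpha>}"

definition arrow_wilf_equiv :: "arrow_pat \<Rightarrow> arrow_pat \<Rightarrow> bool" where
  "arrow_wilf_equiv \<alpha> \<beta> \<longleftrightarrow> (\<forall>n\<ge>1. card (avoiders n \<alpha>) = card (avoiders n \<beta>))"

definition pat_reverse :: "arrow_pat \<Rightarrow> arrow_pat" where
  "pat_reverse \<alpha> = (rev (fst \<alpha>), (snd \<alpha>)\<inverse>)"

definition pat_complement :: "arrow_pat \<Rightarrow> arrow_pat" where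
  "pat_complement \<alpha> =
     (let f = (\<lambda>j. pat_size \<alpha> + 1 - j) in (map f (fst \<alpha>), map_prod f f ` snd \<alpha>))"

definition pat_reverse_complement :: "arrow_pat \<Rightarrow> arrow_pat" where
  "pat_reverse_complement \<alpha> = pat_complement (pat_reverse \<alpha>)"

lemma pat_size_single_arrow:
  assumes "set \<nu> \<subseteq> {1..k}" "{1..k} - set \<nu> = {r}" "c \<in> set \<nu>"
  shows "pat_size (\<nu>, {(r, c)}) = k"
proof -
  have "pat_entries (\<nu>, {(r, c)}) = {1..k}"
    using assms by (auto simp: pat_entries_def)
  then show ?thesis by (simp add: pat_size_def)
qed

lemma is_arrow_pattern_single_arrow:
  assumes "distinct \<nu>" "set \<nu> \<subseteq> {1..k}" "{1..k} - set \<nu> = {r}" "c \<in> set \<nu>"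
  shows "is_arrow_pattern (\<nu>, {(r, c)})"
proof -
  have "pat_entries (\<nu>, {(r, c)}) = {1..k}"
    using assms by (auto simp: pat_entries_def)
  then show ?thesis using assms by (simp add: is_arrow_pattern_def pat_size_def)
qed

end

theory Submission
  imports Defs
begin

text \<open>
  A left-to-right maximum closes the cycle before it, so \<open>hat_perm w\<close> sends \<open>b\<close> to some \<open>c < b\<close> exactly when
  \<open>b\<close> is immediately followed by \<open>c\<close> in the word: the last entry of a cycle is mapped to the
  maximum of that cycle. Arrows \<open>b \<rightarrow> c\<close> with \<open>b > c\<close> therefore require descents at adjacent
  positions, a condition that is compatible with the reverse-complement of permutations.
\<close>

section \<open>Auxiliary facts on subsequences and on the cycles of \<open>hat_perm\<close>\<close>

lemma subseq_rev:
  assumes "subseq xs ys" shows "subseq (rev xs) (rev ys)"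
  using assms
proof induct
  case (list_emb_Cons xs ys y)
  then show ?case by (simp only: rev.simps subseq_rev_drop_many)
next
  case (list_emb_Cons2 x y xs ys)
  then show ?case by (simp only: rev.simps) (rule list_emb_append_mono, simp_all)
qed simp

text \<open>Applying a cycle to every entry of its own list rotates the list by one; the modulus
  sends the last entry back to the head.\<close>

lemma cycle_of_list_nth:
  assumes "distinct ys" and "j < length ys"
  shows "cycle_of_list ys (ys ! j) = ys ! (Suc j mod length ys)"
proof -
  have "map (cycle_of_list ys) ys = rotate1 ys"
    using cyclic_rotation[OF assms(1), of 1] by simp
  then have "cycle_of_list ys (ys ! j) = rotate1 ys ! j"
    using assms(2) by (metis nth_map)
  then show ?thesis
    using assms(2) by (simp add: nth_rotate1)
qed

lemma hat_perm_Nil: "hat_perm [] = id"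
  by (simp add: hat_perm_def)

lemma hat_perm_Cons:
  "hat_perm (x # xs) =
     cycle_of_list (x # takeWhile (\<lambda>y. y \<le> x) xs) \<circ> hat_perm (dropWhile (\<lambda>y. y \<le> x) xs)"
  by (simp add: hat_perm_def)

lemma hat_perm_permutes: "hat_perm w permutes set w"
proof (induction w rule: lr_max_blocks.induct)
  case 1
  show ?case by (simp only: hat_perm_Nil permutes_id)
next
  case (2 x xs)
  let ?ys = "x # takeWhile (\<lambda>y. y \<le> x) xs" and ?zs = "dropWhile (\<lambda>y. y \<le> x) xs"
  have "hat_perm ?zs permutes set (x # xs)"
    using 2 by (rule permutes_subset) (auto dest: set_dropWhileD)
  moreover have "cycle_of_list ?ys permutes set (x # xs)"
    by (rule permutes_subset[OF cycle_permutes]) (auto dest: set_takeWhileD)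
  ultimately show ?case
    unfolding hat_perm_Cons by (rule permutes_compose)
qed

section \<open>Descents of the cycle map as adjacent descents of the word\<close>

lemma sublist_pair_iff:
  "sublist [a, b] w \<longleftrightarrow> (\<exists>j. Suc j < length w \<and> w ! j = a \<and> w ! Suc j = b)"
proof
  assume "sublist [a, b] w"
  then obtain us vs where "w = us @ [a, b] @ vs"
    by (auto simp: sublist_def)
  then show "\<exists>j. Suc j < length w \<and> w ! j = a \<and> w ! Suc j = b"
    by (intro exI[of _ "length us"]) (simp add: nth_append)
next
  assume "\<exists>j. Suc j < length w \<and> w ! j = a \<and> w ! Suc j = b"
  then obtain j where "Suc j < length w" "w ! j = a" "w ! Suc j = b"
    by blast
  then have "w = take j w @ [a, b] @ drop (Suc (Suc j)) w"
    by (metis Cons_nth_drop_Suc Suc_lessD append_Cons append_Nil append_take_drop_id)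
  then show "sublist [a, b] w"
    by (metis sublist_appendI)
qed

text \<open>The one step of the cycle that does not go to the right neighbour leads from the last
  entry to \<open>x\<close>, the largest entry, so it cannot descend.\<close>

lemma cycle_of_list_descent_iff:
  assumes "distinct (x # ys)" and "\<forall>y\<in>set ys. y \<le> x" and "a \<in> set (x # ys)" and "b < (a :: nat)"
  shows "cycle_of_list (x # ys) a = b \<longleftrightarrow> sublist [a, b] (x # ys)"
proof -
  let ?zs = "x # ys"
  obtain j where j: "j < length ?zs" "?zs ! j = a"
    using assms(3) by (meson in_set_conv_nth)
  have eq: "cycle_of_list ?zs a = ?zs ! (Suc j mod length ?zs)"
    using cycle_of_list_nth[OF assms(1) j(1)] j(2) by simp
  \<comment> \<open>By distinctness \<open>j\<close> is the only position of
    \<open>a\<close>.\<close>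
  have sub: "sublist [a, b] ?zs \<longleftrightarrow> Suc j < length ?zs \<and> ?zs ! Suc j = b"
    unfolding sublist_pair_iff using j nth_eq_iff_index_eq[OF assms(1)] by (metis Suc_lessD)
  show ?thesis
  proof (cases "Suc j < length ?zs")
    case True
    then show ?thesis using eq sub by (simp only: mod_less simp_thms)
  next
    case False
    then have "Suc j = length ?zs" using j by linarith
    then have "cycle_of_list ?zs a = x" using eq by (simp only: mod_self nth_Cons_0)
    moreover have "a \<le> x" using assms(2,3) by auto
    ultimately show ?thesis using False sub assms(4) by linarith
  qed
qed

text \<open>Induction over the blocks: an adjacent pair lies inside one block or straddles a cut. A
  straddling pair ascends, because a new block opens with a larger left-to-right maximum, so cutting
  the word destroys no adjacent descent.\<close>

lemma hat_perm_descent_iff: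
  assumes "distinct w" and "b < a"
  shows "hat_perm w a = b \<longleftrightarrow> sublist [a, b] w"
  using assms(1)
proof (induction w rule: lr_max_blocks.induct)
  case 1
  then show ?case using assms(2) by (simp add: hat_perm_Nil)
next
  case (2 x xs)
  define ys where "ys = takeWhile (\<lambda>y. y \<le> x) xs"
  define zs where "zs = dropWhile (\<lambda>y. y \<le> x) xs"
  have w: "x # xs = (x # ys) @ zs" by (simp add: ys_def zs_def)
  have dist: "distinct (x # ys)" "distinct zs" "set (x # ys) \<inter> set zs = {}"
    using "2.prems" unfolding w distinct_append by auto
  have le: "\<forall>y\<in>set ys. y \<le> x" by (auto simp: ys_def dest: set_takeWhileD)
  have IH: "hat_perm zs a = b \<longleftrightarrow> sublist [a, b] zs"
    using "2.IH" dist(2) unfolding zs_def by blast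
  have hat: "hat_perm (x # xs) a = cycle_of_list (x # ys) (hat_perm zs a)"
    by (simp add: hat_perm_Cons ys_def zs_def)
  have cut: "\<not> (suffix [a] (x # ys) \<and> prefix [b] zs)"
  proof
    assume *: "suffix [a] (x # ys) \<and> prefix [b] zs"
    then have "a \<in> set (x # ys)" using set_mono_suffix by fastforce
    then have "a \<le> x" using le by auto
    moreover have "zs \<noteq> []" "hd zs = b" using * by (auto simp: prefix_def)
    then have "x < b" using hd_dropWhile[of "\<lambda>y. y \<le> x" xs] by (simp add: zs_def)
    ultimately show False using assms(2) by simp
  qed
  have sub: "sublist [a, b] (x # xs) \<longleftrightarrow> sublist [a, b] (x # ys) \<or> sublist [a, b] zs"
  proof -
    \<comment> \<open>The only split of \<open>[a, b]\<close> into two nonempty parts is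
      \<open>[a]\<close> and \<open>[b]\<close>, which \<open>cut\<close> rules out.\<close>
    have "\<not> (xs1 @ xs2 = [a, b] \<and> xs1 \<noteq> [] \<and> xs2 \<noteq> [] \<and> suffix xs1 (x # ys) \<and> prefix xs2 zs)"
      for xs1 xs2
      using cut by (cases xs1) (auto simp: append_eq_Cons_conv)
    then show ?thesis
      unfolding w sublist_append
      by (metis append_Nil append_Nil2 prefix_imp_sublist suffix_imp_sublist)
  qed
  have not_sub: "\<not> sublist [a, b] vs" if "a \<notin> set vs" for vs
    using that set_mono_sublist[of "[a, b]" vs] by auto
  show ?case
  proof (cases "a \<in> set (x # ys)")
    case True
    then have "a \<notin> set zs" using dist(3) by blast
    then show ?thesis
      using cycle_of_list_descent_iff[OF dist(1) le True assms(2)]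
        permutes_not_in[OF hat_perm_permutes] not_sub[of zs] hat sub by simp
  next
    case False
    \<comment> \<open>The map of the tail sends \<open>a\<close> into \<open>zs\<close> or fixes it;
      in both cases the image lies outside the first block, whose cycle leaves it unchanged.\<close>
    have "hat_perm (x # xs) a = hat_perm zs a"
    proof (cases "a \<in> set zs")
      case True
      then have "hat_perm zs a \<in> set zs"
        using permutes_in_image[OF hat_perm_permutes] by blast
      then have "hat_perm zs a \<notin> set (x # ys)" using dist(3) by blast
      then show ?thesis unfolding hat by (rule id_outside_supp)
    next
      case notin: False
      then have "hat_perm zs a = a" by (rule permutes_not_in[OF hat_perm_permutes])
      then show ?thesis unfolding hat using id_outside_supp[OF False] by (simp only:)
    qed
    then show ?thesis using IH not_sub[OF False] sub by (simp only: simp_thms)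
  qed
qed

section \<open>Reverse-complement of permutations\<close>

definition word_reverse_complement :: "nat list \<Rightarrow> nat list" where
  "word_reverse_complement w = map (\<lambda>v. length w + 1 - v) (rev w)"

lemma length_word_reverse_complement [simp]:
  "length (word_reverse_complement w) = length w"
  by (simp add: word_reverse_complement_def)

text \<open>The range of the entries keeps the truncated subtraction exact, so complementing twice
  restores each value.\<close>

lemma word_reverse_complement_idem:
  assumes "set w \<subseteq> {1..length w}"
  shows "word_reverse_complement (word_reverse_complement w) = w"
  using assms by (auto simp: word_reverse_complement_def rev_map o_def subset_eq intro!: map_idI)

lemma bij_betw_complement: "bij_betw (\<lambda>v. n + 1 - v) {1..n} {1..n::nat}"
  by (rule bij_betw_byWitness[where f' = "\<lambda>v. n + 1 - v"]) auto

lemma length_permutation: "w \<in> permutations_of_set {1..n} \<Longrightarrow> length w = n"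
  using length_finite_permutations_of_set by fastforce

lemma word_reverse_complement_permutation:
  assumes "w \<in> permutations_of_set {1..n}"
  shows "word_reverse_complement w \<in> permutations_of_set {1..n}"
proof -
  have w: "set w = {1..n}" "distinct w" "length w = n"
    using assms by (auto dest: permutations_of_setD simp: length_permutation)
  then show ?thesis
    using bij_betw_complement[of n]
    by (simp add: permutations_of_set_def word_reverse_complement_def distinct_map bij_betw_def)
qed

section \<open>Reverse-complement of arrow patterns\<close>

lemma pat_entries_reverse [simp]: "pat_entries (pat_reverse \<alpha>) = pat_entries \<alpha>"
  by (force simp: pat_entries_def pat_reverse_def)

text \<open>The complement is taken with the size of the reversed pattern; reversal keeps the set of
  entries, so the original size can be used.\<close>

lemma pat_reverse_complement_eq:
  "pat_reverse_complement (\<nu>, H) =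
     (let f = (\<lambda>j. pat_size (\<nu>, H) + 1 - j) in (map f (rev \<nu>), map_prod f f ` H\<inverse>))"
proof -
  have "pat_size (pat_reverse (\<nu>, H)) = pat_size (\<nu>, H)"
    by (simp add: pat_size_def)
  then show ?thesis
    by (simp add: pat_reverse_complement_def pat_complement_def Let_def)
       (simp add: pat_reverse_def)
qed

lemma pat_entries_reverse_complement:
  "pat_entries (pat_reverse_complement \<alpha>) = (\<lambda>j. pat_size \<alpha> + 1 - j) ` pat_entries \<alpha>"
  by (cases \<alpha>) (force simp: pat_reverse_complement_eq Let_def pat_entries_def)

text \<open>All three facts rest on \<open>f\<close> being an involution of
  \<open>{1..k}\<close>.\<close>

lemma
  assumes "is_arrow_pattern \<alpha>"
  shows pat_size_reverse_complement: "pat_size (pat_reverse_complement \<alpha>) = pat_size \<alpha>"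
    and is_arrow_pattern_reverse_complement: "is_arrow_pattern (pat_reverse_complement \<alpha>)"
    and pat_reverse_complement_idem: "pat_reverse_complement (pat_reverse_complement \<alpha>) = \<alpha>"
proof -
  obtain \<nu> H where \<alpha>: "\<alpha> = (\<nu>, H)" by (cases \<alpha>)
  define k where "k = pat_size \<alpha>"
  define f where "f = (\<lambda>j. k + 1 - j)"
  have entries: "pat_entries \<alpha> = {1..k}" and dist: "distinct \<nu>"
    using assms by (auto simp: is_arrow_pattern_def \<alpha> k_def)
  have bij: "bij_betw f {1..k} {1..k}"
    unfolding f_def by (rule bij_betw_complement)
  have entries': "pat_entries (pat_reverse_complement \<alpha>) = {1..k}"
    using bij unfolding pat_entries_reverse_complement entries
    by (simp add: f_def k_def bij_betw_def)
  then show size: "pat_size (pat_reverse_complement \<alpha>) = pat_size \<alpha>"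
    by (simp add: pat_size_def entries)
  have rc: "pat_reverse_complement \<alpha> = (map f (rev \<nu>), map_prod f f ` H\<inverse>)"
    unfolding \<alpha> pat_reverse_complement_eq Let_def by (simp add: f_def k_def \<alpha>)
  have \<nu>: "set \<nu> \<subseteq> {1..k}" and H: "\<And>b c. (b, c) \<in> H \<Longrightarrow> b \<in> {1..k} \<and> c \<in> {1..k}"
    unfolding entries[symmetric] by (force simp: pat_entries_def \<alpha>)+
  have "inj_on f (set \<nu>)"
    using bij \<nu> by (meson bij_betw_def inj_on_subset)
  then show "is_arrow_pattern (pat_reverse_complement \<alpha>)"
    using entries' size dist by (simp add: is_arrow_pattern_def k_def rc distinct_map)
  have ff: "f (f j) = j" if "j \<in> {1..k}" for j
    using that by (auto simp: f_def)
  have "pat_reverse_complement (pat_reverse_complement \<alpha>) =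
      (map f (rev (map f (rev \<nu>))), map_prod f f ` (map_prod f f ` H\<inverse>)\<inverse>)"
    using size unfolding rc pat_reverse_complement_eq Let_def by (simp add: f_def k_def)
  moreover have "map f (rev (map f (rev \<nu>))) = \<nu>"
    using ff \<nu> by (auto simp: rev_map o_def intro!: map_idI)
  \<comment> \<open>The two converses cancel, leaving \<open>f\<close> applied twice to each end of
    an arrow.\<close>
  moreover have "map_prod f f ` (map_prod f f ` H\<inverse>)\<inverse> = (\<lambda>(b, c). (f (f b), f (f c))) ` H"
    by force
  moreover have "\<dots> = id ` H"
    using ff H by (intro image_cong) auto
  ultimately show "pat_reverse_complement (pat_reverse_complement \<alpha>) = \<alpha>"
    by (simp add: \<alpha>)
qed

text \<open>Reversal flips each arrow and complementation flips the order, so the two effects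
  cancel. This lets the transfer of containment be applied to the transformed pattern as
  well.\<close>

lemma descending_arrows_reverse_complement:
  assumes "is_arrow_pattern \<alpha>" and "\<forall>(b, c)\<in>snd \<alpha>. c < b"
  shows "\<forall>(b, c)\<in>snd (pat_reverse_complement \<alpha>). c < b"
proof -
  obtain \<nu> H where \<alpha>: "\<alpha> = (\<nu>, H)" by (cases \<alpha>)
  have "b \<in> {1..pat_size \<alpha>}" if "(b, c) \<in> H" for b c
    using assms(1) that unfolding is_arrow_pattern_def by (force simp: pat_entries_def \<alpha>)
  then show ?thesis
    using assms(2) by (fastforce simp: \<alpha> pat_reverse_complement_eq Let_def)
qed

section \<open>Transfer of occurrences and the resulting equivalence\<close>

lemma contains_pat_reverse_complement:
  assumes w: "w \<in> permutations_of_set {1..n}" and \<alpha>: "is_arrow_pattern \<alpha>"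
    and desc: "\<forall>(b, c)\<in>snd \<alpha>. c < b" and contains: "contains_pat w \<alpha>"
  shows "contains_pat (word_reverse_complement w) (pat_reverse_complement \<alpha>)"
proof -
  obtain \<nu> H where \<alpha>_eq: "\<alpha> = (\<nu>, H)" by (cases \<alpha>)
  define k where "k = pat_size \<alpha>"
  define f where "f = (\<lambda>j. k + 1 - j)"
  define g where "g = (\<lambda>v. n + 1 - v)"
  have [simp]: "length w = n" using w by (rule length_permutation)
  obtain x where mono: "strict_mono_on {1..k} x" and range: "x ` {1..k} \<subseteq> {1..n}"
    and sub: "subseq (map x \<nu>) w" and arrows: "\<forall>(b, c)\<in>H. hat_perm w (x b) = x c"
    using contains by (auto simp: contains_pat_def k_def \<alpha>_eq)
  have entries: "pat_entries \<alpha> = {1..k}"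
    using \<alpha> by (simp add: is_arrow_pattern_def k_def)
  have \<nu>: "set \<nu> \<subseteq> {1..k}" and H: "\<And>b c. (b, c) \<in> H \<Longrightarrow> b \<in> {1..k} \<and> c \<in> {1..k}"
    unfolding entries[symmetric] by (force simp: pat_entries_def \<alpha>_eq)+
  have rc: "pat_reverse_complement \<alpha> = (map f (rev \<nu>), map_prod f f ` H\<inverse>)"
    unfolding \<alpha>_eq pat_reverse_complement_eq Let_def by (simp add: f_def k_def \<alpha>_eq)
  have wrc: "word_reverse_complement w = map g (rev w)"
    by (simp add: word_reverse_complement_def g_def)
  have ff: "f (f j) = j" and f_in: "f j \<in> {1..k}" if "j \<in> {1..k}" for j
    using that by (auto simp: f_def)
  \<comment> \<open>The new occurrence uses the complemented values in the opposite order: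
    \<open>f\<close> and \<open>g\<close> both reverse order, so \<open>y\<close> increases
    again.\<close>
  define y where "y = (\<lambda>j. g (x (f j)))"
  have yf: "y (f j) = g (x j)" if "j \<in> {1..k}" for j
    using ff[OF that] by (simp add: y_def)
  have x_in: "x j \<in> {1..n}" if "j \<in> {1..k}" for j
    using range that by blast
  have "strict_mono_on {1..k} y"
  proof (rule strict_mono_onI)
    fix i j assume ij: "i \<in> {1..k}" "j \<in> {1..k}" "i < j"
    then have "x (f j) < x (f i)"
      using strict_mono_onD[OF mono] f_in by (auto simp: f_def)
    then show "y i < y j"
      using x_in[OF f_in[OF ij(1)]] by (auto simp: y_def g_def)
  qed
  moreover have "y j \<in> {1..n}" if "j \<in> {1..k}" for j
    using x_in[OF f_in[OF that]] by (auto simp: y_def g_def)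
  then have "y ` {1..k} \<subseteq> {1..n}" by blast
  moreover have "subseq (map y (map f (rev \<nu>))) (map g (rev w))"
  proof -
    have "map y (map f (rev \<nu>)) = map g (rev (map x \<nu>))"
      using yf \<nu> by (auto simp: rev_map)
    then show ?thesis
      using subseq_map[OF subseq_rev[OF sub]] by (simp only:)
  qed
  moreover have "hat_perm (map g (rev w)) (y (f c)) = y (f b)" if bc: "(b, c) \<in> H" for b c
  proof -
    have b: "b \<in> {1..k}" and c: "c \<in> {1..k}" using H[OF bc] by auto
    have "c < b" using desc bc by (auto simp: \<alpha>_eq)
    then have lt: "x c < x b" using strict_mono_onD[OF mono c b] by simp
    have "hat_perm w (x b) = x c" using arrows bc by blast
    then have "sublist [x b, x c] w"
      using hat_perm_descent_iff[OF _ lt] permutations_of_setD(2)[OF w] by blast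
    \<comment> \<open>The adjacent descent \<open>x b\<close>, \<open>x c\<close> becomes the
      adjacent pair \<open>g (x c)\<close>, \<open>g (x b)\<close>. It descends again, so
      \<open>hat_perm_descent_iff\<close> read backwards yields the flipped arrow.\<close>
    then have "sublist (map g (rev [x b, x c])) (map g (rev w))"
      by (intro map_mono_sublist) (simp only: sublist_rev)
    moreover have "g (x b) < g (x c)"
      using lt x_in[OF b] by (auto simp: g_def)
    moreover have "distinct (map g (rev w))"
      using word_reverse_complement_permutation[OF w] permutations_of_setD(2)
      by (simp add: wrc)
    ultimately show ?thesis
      using hat_perm_descent_iff yf[OF b] yf[OF c] by simp
  qed
  then have "\<forall>(b, c)\<in>map_prod f f ` H\<inverse>. hat_perm (map g (rev w)) (y b) = y c"
    by auto
  ultimately show ?thesis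
    unfolding contains_pat_def pat_size_reverse_complement[OF \<alpha>] wrc
    by (intro exI[of _ y]) (simp add: rc k_def)
qed

text \<open>Stated for any set of descending arrows, since adjacency is checked arrow by arrow.
  Reverse-complement of words is its own inverse and exchanges the two sets of avoiders.\<close>

theorem arrow_wilf_equiv_reverse_complement:
  assumes \<alpha>: "is_arrow_pattern \<alpha>" and desc: "\<forall>(b, c)\<in>snd \<alpha>. c < b"
  shows "arrow_wilf_equiv \<alpha> (pat_reverse_complement \<alpha>)"
proof -
  \<comment> \<open>A general \<beta> serves both directions: it is taken to be \<alpha> and then
    the reverse-complement of \<alpha>.\<close>
  have into: "word_reverse_complement w \<in> avoiders n (pat_reverse_complement \<beta>)"
    if "w \<in> avoiders n \<beta>" "is_arrow_pattern \<beta>" "\<forall>(b, c)\<in>snd \<beta>. c < b" for w n \<beta>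
  proof -
    have w: "w \<in> permutations_of_set {1..n}" "\<not> contains_pat w \<beta>"
      using that(1) by (auto simp: avoiders_def)
    have rc: "word_reverse_complement (word_reverse_complement w) = w"
      using w(1) by (intro word_reverse_complement_idem)
        (simp add: length_permutation permutations_of_setD)
    \<comment> \<open>An occurrence here would be transferred a second time; both involutions then
      return to \<open>w\<close> and \<beta>, contradicting avoidance.\<close>
    have "\<not> contains_pat (word_reverse_complement w) (pat_reverse_complement \<beta>)"
      using contains_pat_reverse_complement[OF word_reverse_complement_permutation[OF w(1)]
          is_arrow_pattern_reverse_complement[OF that(2)]
          descending_arrows_reverse_complement[OF that(2,3)]] w(2)
      by (auto simp: rc pat_reverse_complement_idem[OF that(2)])
    then show ?thesis
      using word_reverse_complement_permutation[OF w(1)] by (simp add: avoiders_def)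
  qed
  have idem: "word_reverse_complement (word_reverse_complement w) = w" if "w \<in> avoiders n \<beta>"
    for w n \<beta>
    using that by (intro word_reverse_complement_idem)
      (auto simp: avoiders_def length_permutation permutations_of_setD)
  have "bij_betw word_reverse_complement (avoiders n \<alpha>) (avoiders n (pat_reverse_complement \<alpha>))"
    for n
  proof (rule bij_betw_byWitness[where f' = word_reverse_complement])
    show "word_reverse_complement ` avoiders n (pat_reverse_complement \<alpha>) \<subseteq> avoiders n \<alpha>"
      using into[OF _ is_arrow_pattern_reverse_complement[OF \<alpha>]
          descending_arrows_reverse_complement[OF \<alpha> desc]]
      by (auto simp: pat_reverse_complement_idem[OF \<alpha>])
    show "word_reverse_complement ` avoiders n \<alpha> \<subseteq> avoiders n (pat_reverse_complement \<alpha>)"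
      using into[OF _ \<alpha> desc] by blast
  qed (rule ballI, erule idem)+
  then have "card (avoiders n \<alpha>) = card (avoiders n (pat_reverse_complement \<alpha>))" for n
    by (rule bij_betw_same_card)
  then show ?thesis
    unfolding arrow_wilf_equiv_def by (intro allI impI)
qed

theorem proposition2p4:
  fixes k r i :: nat and \<nu> :: "nat list" and \<alpha> :: arrow_pat
  assumes "length \<nu> = k - 1" and "distinct \<nu>" and "set \<nu> \<subseteq> {1..k}"
    and "{1..k} - set \<nu> = {r}"
    and "i \<in> {1..k - 1}" and "r > \<nu> ! (i - 1)"
    and "\<alpha> = (\<nu>, {(r, \<nu> ! (i - 1))})"
  shows "arrow_wilf_equiv \<alpha> (pat_reverse_complement \<alpha>)"
proof (rule arrow_wilf_equiv_reverse_complement)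
  \<comment> \<open>List positions start at 0, so the range of \<open>i\<close> places
    \<open>i - 1\<close> below the length \<open>k - 1\<close>.\<close>
  have "\<nu> ! (i - 1) \<in> set \<nu>"
    using assms(1,5) by (intro nth_mem) auto
  then show "is_arrow_pattern \<alpha>"
    unfolding assms(7) by (rule is_arrow_pattern_single_arrow[OF assms(2-4)])
  show "\<forall>(b, c)\<in>snd \<alpha>. c < b"
    using assms(6,7) by simp
qed

end
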